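(* Let $k\ge 2$ be an integer, let $D\subset\mathbb{Z}^3$ be a set of cardinality $k^2$, let $a,b,c$ be coprime integers (i.e. $\gcd(a,b,c)=1$), and let $\varphi$ be the projection along $(a,b,c)$. Then $\varphi(\mathcal{F}^3(k,D))$ is a null set (has two-dimensional Lebesgue measure zero) if and only if at least one of the following holds: $(ja,jb,jc)\in\mathcal{E}^3(k,\Delta(D))$ for some real number $j\neq 0$; or $\mathbf{0}\in\mathbb{R}^3$ has a $(k,\Delta(D))$-expansion, of some length $t\ge 1$, other than the trivial expansion $(\mathbf{0})_{0\le i<t}$.
   Context: For an integer $k\ge 2$ and a finite set $D\subset\mathbb{R}^n$, $\mathcal{F}^n(k,D)$ denotes the unique nonempty compact set $T\subset\mathbb{R}^n$ with $T=\bigcup_{d\in D}\frac{T+d}{k}$. A $(k,D)$-expansion of length $t$ of a point $x\in\mathbb{R}^n$ is a sequence $(d_i)_{0\le i<t}$ of elements of $D$ with $x=\sum_{i=0}^{t-1}k^i d_i$. $\mathcal{E}^n(k,D)\subset\mathbb{R}^n$ is the set of all points having a $(k,D)$-expansion of some length $t\ge1$. $\Delta(D)=\{x-y\mid x,y\in D\}$. The projection along a nonzero vector $v\in\mathbb{R}^3$ is a surjective linear map $\varphi:\mathbb{R}^3\to\mathbb{R}^2$ with kernel $\mathbb{R}v$ (being a null set does not depend on the choice). *)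

theory Defs
  imports "HOL-Analysis.Analysis"
begin

(* The description is well-defined whenever k >= 2 and D is finite and nonempty
   (Hutchinson's theorem for the contractions x |-> (x + d) / k); for other
   arguments the value carries no meaning. *)
definition attractor :: "nat \<Rightarrow> (real ^ 'n) set \<Rightarrow> (real ^ 'n) set" where
  "attractor k D = (THE T. T \<noteq> {} \<and> compact T \<and> T = (\<Union>d\<in>D. (\<lambda>x. (x + d) /\<^sub>R real k) ` T))"

(* The length of the expansion is the length of the digit list; the digit of
   weight k^0 comes first. *)
definition is_expansion :: "nat \<Rightarrow> (real ^ 'n) set \<Rightarrow> (real ^ 'n) list \<Rightarrow> real ^ 'n \<Rightarrow> bool" where
  "is_expansion k D ds x \<longleftrightarrow>
     set ds \<subseteq> D \<and> x = (\<Sum>i<length ds. real k ^ i *\<^sub>R (ds ! i))"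

definition expandable :: "nat \<Rightarrow> (real ^ 'n) set \<Rightarrow> (real ^ 'n) set" where
  "expandable k D = {x. \<exists>t\<ge>1. \<exists>ds. length ds = t \<and> is_expansion k D ds x}"

definition differences :: "(real ^ 'n) set \<Rightarrow> (real ^ 'n) set" where
  "differences D = {x - y | x y. x \<in> D \<and> y \<in> D}"

(* For linear surjections real^3 -> real^2 the kernel is one-dimensional, so
   the condition already forces v to be nonzero. *)
definition is_projection_along :: "real ^ 3 \<Rightarrow> (real ^ 3 \<Rightarrow> real ^ 2) \<Rightarrow> bool" where
  "is_projection_along v \<phi> \<longleftrightarrow> linear \<phi> \<and> surj \<phi> \<and> {x. \<phi> x = 0} = range (\<lambda>r::real. r *\<^sub>R v)"

end

theory Submission
  imports Defs
begin

text \<open>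
  Let \<open>X = \<phi> ` attractor k D\<close>. For every \<open>t\<close>, \<open>X\<close> is the union of the copies
  \<open>(X + \<phi> s) / k^t\<close>, where \<open>s\<close> runs over the values of the \<open>k^(2t)\<close> digit strings of length
  \<open>t\<close> over \<open>D\<close>. The right-hand side says exactly that, for some \<open>t\<close>, two different strings have the
  same image under \<open>\<phi>\<close>. In that case at most \<open>k^(2t) - 1\<close> copies are needed, each of measure
  \<open>|X| / k^(2t)\<close>, so \<open>|X| = 0\<close>. Otherwise the images are \<open>k^(2t)\<close> distinct points of \<open>\<phi>(\<int>\<^sup>3)\<close>,
  which is uniformly discrete because the direction of projection is integral. Hence \<open>X\<close> contains
  \<open>k^(2t)\<close> points that are \<open>\<gamma> / k^t\<close>-separated; discs of radius \<open>\<gamma> / (2 k^t)\<close> around them have a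
  total area that does not depend on \<open>t\<close> and lie in arbitrarily small neighbourhoods of the compact
  set \<open>X\<close>, so \<open>|X| > 0\<close>.
\<close>

section \<open>The attractor\<close>

definition hutchinson :: "nat \<Rightarrow> (real ^ 'n) set \<Rightarrow> (real ^ 'n) set \<Rightarrow> (real ^ 'n) set" where
  "hutchinson k D T = (\<Union>d\<in>D. (\<lambda>x. (x + d) /\<^sub>R real k) ` T)"

lemma hutchinson_mono: "A \<subseteq> B \<Longrightarrow> hutchinson k D A \<subseteq> hutchinson k D B"
  unfolding hutchinson_def by blast

lemma compact_hutchinson: "finite D \<Longrightarrow> compact T \<Longrightarrow> compact (hutchinson k D T)"
  unfolding hutchinson_def
  by (intro compact_UN compact_continuous_image continuous_intros) auto

text \<open>A large ball is mapped into itself, so its iterates form a decreasing sequence of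
  nonempty compact sets; their intersection is a fixed point.\<close>

lemma hutchinson_fixpoint_exists:
  fixes D :: "(real ^ 'n) set"
  assumes k: "k \<ge> 2" and D: "finite D" "D \<noteq> {}"
  shows "\<exists>T. T \<noteq> {} \<and> compact T \<and> T = hutchinson k D T"
proof -
  let ?F = "hutchinson k D"
  obtain R where R: "R > 0" "\<And>d. d \<in> D \<Longrightarrow> norm d \<le> R"
    using finite_imp_bounded[OF D(1)] unfolding bounded_pos by blast
  \<comment> \<open>Since \<open>R\<close> also bounds the digits, \<open>(x + d) / k\<close> has
    norm at most \<open>2 * R / k\<close>, hence at most \<open>R\<close>, on this ball.\<close>
  define B where "B = cball (0 :: real ^ 'n) R"
  define S where "S n = (?F ^^ n) B" for n
  have FB: "?F B \<subseteq> B"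
  proof
    fix y assume "y \<in> ?F B"
    then obtain x d where xd: "norm x \<le> R" "d \<in> D" "y = (x + d) /\<^sub>R real k"
      unfolding hutchinson_def B_def by auto
    have "norm (x + d) \<le> 2 * R"
      using norm_triangle_ineq[of x d] xd R(2)[of d] by linarith
    also have "\<dots> \<le> real k * R"
      using k R by (intro mult_right_mono) auto
    finally have "norm (x + d) / real k \<le> R"
      using k by (simp add: field_simps)
    then show "y \<in> B"
      unfolding xd(3) B_def mem_cball_0 norm_scaleR by (simp add: divide_inverse mult.commute)
  qed
  have S_Suc: "S (Suc n) = ?F (S n)" for n
    by (simp add: S_def)
  have S_dec: "S (Suc n) \<subseteq> S n" for n
    by (induction n) (use FB in \<open>auto simp: S_def dest: hutchinson_mono[THEN subsetD, rotated]\<close>)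
  then have S_anti: "S n \<subseteq> S m" if "m \<le> n" for m n
    using that by (rule lift_Suc_antimono_le)
  have S_compact: "compact (S n)" for n
    by (induction n) (auto simp: S_def B_def intro: compact_hutchinson D)
  have S_ne: "S n \<noteq> {}" for n
    by (induction n) (use R D in \<open>auto simp: S_def B_def hutchinson_def\<close>)
  define T where "T = (\<Inter>n. S n)"
  have "T \<noteq> {}"
    unfolding T_def using S_compact S_ne S_anti by (intro compact_nest) auto
  moreover have "compact T"
    unfolding T_def using S_compact by (intro compact_Inter) auto
  moreover have "T = ?F T"
  proof
    show "?F T \<subseteq> T"
    proof -
      have "?F T \<subseteq> S n" for n
      proof -
        have "?F T \<subseteq> ?F (S n)"
          by (rule hutchinson_mono) (auto simp: T_def)
        then show ?thesis
          using S_dec[of n] S_Suc by auto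
      qed
      then show ?thesis by (auto simp: T_def)
    qed
    show "T \<subseteq> ?F T"
    proof
      fix x assume x: "x \<in> T"
      have "\<exists>d\<in>D. real k *\<^sub>R x - d \<in> S n" for n
      proof -
        have "x \<in> ?F (S n)"
          using x S_Suc[of n] by (auto simp: T_def)
        then obtain d y where "d \<in> D" "y \<in> S n" "x = (y + d) /\<^sub>R real k"
          unfolding hutchinson_def by blast
        then show ?thesis
          using k by (intro bexI[of _ d]) simp_all
      qed
      then obtain f where f: "\<And>n. f n \<in> D" "\<And>n. real k *\<^sub>R x - f n \<in> S n"
        by metis
      \<comment> \<open>The digit \<open>f n\<close> may vary with \<open>n\<close>. As
        \<open>D\<close> is finite, one digit occurs for infinitely many \<open>n\<close>, and
        because the \<open>S n\<close> decrease it then serves every level.\<close>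
      have "finite (range f)"
        using f(1) D(1) by (meson finite_subset image_subsetI)
      then obtain n0 where inf: "infinite {n. f n = f n0}"
        using pigeonhole_infinite[of UNIV f] by auto
      define d where "d = f n0"
      have "real k *\<^sub>R x - d \<in> S m" for m
      proof -
        obtain n where "n \<ge> m" "f n = d"
          using inf unfolding d_def infinite_nat_iff_unbounded_le by blast
        then show ?thesis
          using f(2)[of n] S_anti by blast
      qed
      then have "real k *\<^sub>R x - d \<in> T" by (simp add: T_def)
      moreover have "x = ((real k *\<^sub>R x - d) + d) /\<^sub>R real k" using k by simp
      ultimately show "x \<in> ?F T"
        unfolding hutchinson_def using f(1) d_def by blast
    qed
  qed
  ultimately show ?thesis by blast
qed

text \<open>A point of \<open>T\<close> at maximal distance \<open>m\<close> from \<open>T'\<close> gives \<open>m \<le> m / k\<close>.\<close>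
lemma hutchinson_fixpoint_subset:
  fixes D :: "(real ^ 'n) set"
  assumes k: "k \<ge> 2"
    and T: "T \<noteq> {}" "compact T" "T = hutchinson k D T"
    and T': "T' \<noteq> {}" "compact T'" "T' = hutchinson k D T'"
  shows "T \<subseteq> T'"
proof -
  have "continuous_on T (\<lambda>x. infdist x T')"
    by (intro continuous_intros)
  then obtain x where x: "x \<in> T" "\<And>y. y \<in> T \<Longrightarrow> infdist y T' \<le> infdist x T'"
    using continuous_attains_sup[of T "\<lambda>x. infdist x T'"] T by blast
  obtain y d where yd: "y \<in> T" "d \<in> D" "x = (y + d) /\<^sub>R real k"
    using x(1) T(3) unfolding hutchinson_def by blast
  obtain z where z: "z \<in> T'" "infdist y T' = dist y z"
    using infdist_attains_inf[OF compact_imp_closed[OF T'(2)] T'(1)] by metis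
  have "(z + d) /\<^sub>R real k \<in> T'"
    using T'(3) z(1) yd(2) unfolding hutchinson_def by blast
  then have "infdist x T' \<le> dist x ((z + d) /\<^sub>R real k)"
    by (rule infdist_le)
  also have "\<dots> = dist y z / real k"
  proof -
    have "x - (z + d) /\<^sub>R real k = (y - z) /\<^sub>R real k"
      by (simp add: yd(3) algebra_simps)
    then show ?thesis
      by (simp add: dist_norm divide_inverse mult.commute)
  qed
  also have "\<dots> \<le> infdist x T' / 2"
    using k z(2) x(2)[OF yd(1)] infdist_nonneg[of x T'] by (intro frac_le) auto
  finally have "infdist x T' \<le> 0" by simp
  then have "infdist w T' = 0" if "w \<in> T" for w
    using x(2)[OF that] infdist_nonneg[of w T'] by linarith
  then show ?thesis
    using in_closed_iff_infdist_zero[OF compact_imp_closed[OF T'(2)] T'(1)] by blast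
qed

text \<open>Existence, and uniqueness by mutual inclusion, make the definite description in
  \<open>attractor\<close> meaningful.\<close>

lemma attractor_properties:
  fixes D :: "(real ^ 'n) set"
  assumes "k \<ge> 2" "finite D" "D \<noteq> {}"
  shows "attractor k D \<noteq> {}" "compact (attractor k D)"
    "attractor k D = hutchinson k D (attractor k D)"
proof -
  let ?P = "\<lambda>T. T \<noteq> {} \<and> compact T \<and> T = hutchinson k D T"
  have "\<exists>!T. ?P T"
    using hutchinson_fixpoint_exists[OF assms] hutchinson_fixpoint_subset[OF assms(1)]
    by (metis subset_antisym)
  then have "?P (THE T. ?P T)" by (rule theI')
  then show "attractor k D \<noteq> {}" "compact (attractor k D)"
    "attractor k D = hutchinson k D (attractor k D)"
    unfolding attractor_def hutchinson_def by blast+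
qed

section \<open>Values of digit strings\<close>

text \<open>The sum from \<open>is_expansion\<close> as a function of the list alone; with the
  lowest weight first it obeys a Horner recursion along the list.\<close>

definition digit_value :: "nat \<Rightarrow> (real ^ 'n) list \<Rightarrow> real ^ 'n" where
  "digit_value k ds = (\<Sum>i<length ds. real k ^ i *\<^sub>R (ds ! i))"

definition digit_strings :: "'a set \<Rightarrow> nat \<Rightarrow> 'a list set" where
  "digit_strings D t = {ds. set ds \<subseteq> D \<and> length ds = t}"

lemma digit_value_Nil [simp]: "digit_value k [] = 0"
  by (simp add: digit_value_def)

lemma digit_value_Cons [simp]: "digit_value k (d # ds) = d + real k *\<^sub>R digit_value k ds"
  by (simp add: digit_value_def sum.lessThan_Suc_shift scaleR_right.sum del: sum.lessThan_Suc)

lemma digit_value_diff: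
  "length xs = length ys \<Longrightarrow>
    digit_value k (map2 (-) xs ys) = digit_value k xs - digit_value k ys"
  by (induction xs ys rule: list_induct2) (simp_all add: scaleR_diff_right)

lemma digit_value_Ints:
  assumes "\<And>d i. d \<in> D \<Longrightarrow> d $ i \<in> \<int>" "set ds \<subseteq> D"
  shows "digit_value k ds $ i \<in> \<int>"
  using assms(2) by (induction ds) (auto intro!: Ints_add Ints_mult assms(1))

lemma digit_strings_0: "digit_strings D 0 = {[]}"
  by (auto simp: digit_strings_def)

lemma digit_strings_Suc: "digit_strings D (Suc t) = (\<lambda>(d, ds). d # ds) ` (D \<times> digit_strings D t)"
  by (auto simp: digit_strings_def length_Suc_conv image_iff)

lemma finite_digit_strings: "finite D \<Longrightarrow> finite (digit_strings D t)"
  by (simp add: digit_strings_def finite_lists_length_eq)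

lemma card_digit_strings: "finite D \<Longrightarrow> card (digit_strings D t) = card D ^ t"
  by (simp add: digit_strings_def card_lists_length_eq)

text \<open>Replacing the innermost \<open>T\<close> by \<open>hutchinson k D T\<close> inserts a
  new digit of weight 1 and raises the weight of all others by a factor \<open>k\<close>, which is
  the recursion for \<open>d # ds\<close>.\<close>

lemma hutchinson_fixpoint_iterate:
  assumes k: "k > 0" and T: "T = hutchinson k D T"
  shows "T = (\<Union>ds\<in>digit_strings D t. (\<lambda>x. (x + digit_value k ds) /\<^sub>R real k ^ t) ` T)"
proof (induction t)
  case 0
  then show ?case by (simp add: digit_strings_0)
next
  case (Suc t)
  have step: "((y + d) /\<^sub>R real k + digit_value k ds) /\<^sub>R real k ^ t =
      (y + digit_value k (d # ds)) /\<^sub>R real k ^ Suc t" for y d ds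
    using k by (simp add: algebra_simps)
  have "T = (\<Union>ds\<in>digit_strings D t.
      (\<lambda>x. (x + digit_value k ds) /\<^sub>R real k ^ t) ` hutchinson k D T)"
    using Suc T by simp
  also have "\<dots> = (\<Union>ds\<in>digit_strings D t. \<Union>d\<in>D.
      (\<lambda>y. (y + digit_value k (d # ds)) /\<^sub>R real k ^ Suc t) ` T)"
    unfolding hutchinson_def image_UN image_image step ..
  also have "\<dots> = (\<Union>ds\<in>digit_strings D (Suc t).
      (\<lambda>x. (x + digit_value k ds) /\<^sub>R real k ^ Suc t) ` T)"
    unfolding digit_strings_Suc by fast
  finally show ?case .
qed

lemma differences_list_split:
  assumes "set ds \<subseteq> differences D"
  shows "\<exists>xs ys. set xs \<subseteq> D \<and> set ys \<subseteq> D \<and> length xs = length ds \<and> length ys = length ds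
    \<and> ds = map2 (-) xs ys"
proof -
  have "\<forall>d\<in>differences D. \<exists>x y. x \<in> D \<and> y \<in> D \<and> d = x - y"
    by (auto simp: differences_def)
  then obtain p q where pq: "\<And>d. d \<in> differences D \<Longrightarrow> p d \<in> D \<and> q d \<in> D \<and> d = p d - q d"
    by metis
  have "ds = map2 (-) (map p ds) (map q ds)"
    using pq assms by (intro nth_equalityI) (auto dest: nth_mem)
  then show ?thesis
    using pq assms by (intro exI[of _ "map p ds"] exI[of _ "map q ds"]) auto
qed

lemma map2_diff_eq_replicate_0_iff:
  fixes xs ys :: "'a :: group_add list"
  shows "length xs = length ys \<Longrightarrow> map2 (-) xs ys = replicate (length xs) 0 \<longleftrightarrow> xs = ys"
  by (induction xs ys rule: list_induct2) auto

lemma set_map2_diff_subset: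
  "length xs = length ys \<Longrightarrow> set xs \<subseteq> D \<Longrightarrow> set ys \<subseteq> D \<Longrightarrow>
    set (map2 (-) xs ys) \<subseteq> differences D"
  by (induction xs ys rule: list_induct2) (auto simp: differences_def)

text \<open>Colliding strings are subtracted digit by digit; conversely each difference digit is
  split separately. Injectivity is tested on strings rather than on their values, so two strings
  with equal value also collide: this is how expansions of zero enter.\<close>

lemma collision_iff_difference_expansion:
  assumes "linear \<phi>"
  shows "\<not> inj_on (\<lambda>ds. \<phi> (digit_value k ds)) (digit_strings D t) \<longleftrightarrow>
    (\<exists>ds. length ds = t \<and> set ds \<subseteq> differences D \<and> \<phi> (digit_value k ds) = 0 \<and>
      ds \<noteq> replicate t 0)" (is "?L \<longleftrightarrow> ?R")
proof
  assume ?L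
  then obtain xs ys where *: "set xs \<subseteq> D" "length xs = t" "set ys \<subseteq> D" "length ys = t" "xs \<noteq> ys"
      "\<phi> (digit_value k xs) = \<phi> (digit_value k ys)"
    by (auto simp: inj_on_def digit_strings_def)
  have "map2 (-) xs ys \<noteq> replicate t 0"
    using map2_diff_eq_replicate_0_iff[of xs ys] * by auto
  moreover have "\<phi> (digit_value k (map2 (-) xs ys)) = 0"
    using * by (simp add: digit_value_diff linear_diff[OF assms])
  moreover have "set (map2 (-) xs ys) \<subseteq> differences D"
    using * by (intro set_map2_diff_subset) auto
  ultimately show ?R
    using * by (intro exI[of _ "map2 (-) xs ys"]) auto
next
  assume ?R
  then obtain ds where ds: "length ds = t" "set ds \<subseteq> differences D" "\<phi> (digit_value k ds) = 0"
      "ds \<noteq> replicate t 0" by blast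
  obtain xs ys where *: "set xs \<subseteq> D" "set ys \<subseteq> D" "length xs = length ds"
      "length ys = length ds" "ds = map2 (-) xs ys"
    using differences_list_split[OF ds(2)] by blast
  have "xs \<noteq> ys"
    using map2_diff_eq_replicate_0_iff[of xs ys] ds(1,4) *(3-5) by metis
  moreover have "\<phi> (digit_value k xs) = \<phi> (digit_value k ys)"
    using ds(3) digit_value_diff[of xs ys k] *(3,4) unfolding *(5)[symmetric]
    by (simp add: linear_diff[OF assms])
  moreover have "xs \<in> digit_strings D t" "ys \<in> digit_strings D t"
    using *(1-4) ds(1) by (auto simp: digit_strings_def)
  ultimately show ?L
    unfolding inj_on_def by blast
qed

section \<open>Measure estimates\<close>

text \<open>Each copy has measure \<open>|X| / c^n\<close> in dimension \<open>n\<close>, so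
  \<open>|X|\<close> is at most \<open>|X|\<close> times a factor below 1. Compactness makes
  \<open>|X|\<close> finite, which forces it to be 0.\<close>

lemma null_set_if_few_scaled_copies:
  fixes X :: "'a :: euclidean_space set"
  assumes X: "compact X" and S: "finite S" and c: "c > 0"
    and cover: "X \<subseteq> (\<Union>s\<in>S. (\<lambda>x. (x + s) /\<^sub>R c) ` X)"
    and card: "real (card S) < c ^ DIM('a)"
  shows "X \<in> null_sets lebesgue"
proof -
  have meas: "(\<lambda>x. (x + s) /\<^sub>R c) ` X \<in> lmeasurable" for s
    by (intro lmeasurable_compact compact_continuous_image continuous_intros X)
  \<comment> \<open>The map is affine with ratio \<open>inverse c\<close> and translation
    \<open>s /\<^sub>R c\<close>.\<close>
  have val: "measure lebesgue ((\<lambda>x. (x + s) /\<^sub>R c) ` X) = measure lebesgue X / c ^ DIM('a)" for s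
    using measure_lebesgue_affine[of "inverse c" "s /\<^sub>R c" X] c
    by (simp add: scaleR_add_right field_simps)
  have "measure lebesgue X \<le> measure lebesgue (\<Union>s\<in>S. (\<lambda>x. (x + s) /\<^sub>R c) ` X)"
    using meas lmeasurable_compact[OF X] cover S
    by (intro measure_mono_fmeasurable fmeasurable.finite_UN) auto
  also have "\<dots> \<le> (\<Sum>s\<in>S. measure lebesgue ((\<lambda>x. (x + s) /\<^sub>R c) ` X))"
    using meas S by (intro measure_UNION_le) auto
  also have "\<dots> = real (card S) / c ^ DIM('a) * measure lebesgue X"
    by (simp add: val)
  finally have "measure lebesgue X \<le> real (card S) / c ^ DIM('a) * measure lebesgue X" .
  moreover have "real (card S) / c ^ DIM('a) < 1"
    using card c by simp
  ultimately have "measure lebesgue X = 0"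
    using measure_nonneg[of lebesgue X]
    by (metis mult_le_cancel_right1 order_le_less linorder_not_le)
  then show ?thesis
    using lmeasurable_compact[OF X] negligible_iff_measure0 negligible_iff_null_sets by blast
qed

text \<open>Outer regularity gives an open set of small measure around \<open>X\<close>, and
  compactness a uniform radius \<open>\<epsilon>\<close> for balls that stay inside it. This
  \<open>\<epsilon>\<close> is fixed before \<open>\<delta>\<close> and \<open>P\<close>, so
  arbitrarily fine packings can be tested against the same bound \<open>C\<close>.\<close>

lemma packing_in_compact_null_set:
  fixes X :: "'a :: euclidean_space set"
  assumes X: "compact X" "X \<in> null_sets lebesgue" and C: "C > 0"
  shows "\<exists>\<epsilon>>0. \<forall>\<delta> P. 0 < \<delta> \<longrightarrow> \<delta> \<le> \<epsilon> \<longrightarrow> finite P \<longrightarrow> P \<subseteq> X \<longrightarrow>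
    (\<forall>x\<in>P. \<forall>y\<in>P. x \<noteq> y \<longrightarrow> dist x y \<ge> 2 * \<delta>) \<longrightarrow> real (card P) * \<delta> ^ DIM('a) < C"
proof -
  \<comment> \<open>The volume of the unit ball; aiming at \<open>C * V\<close> lets it cancel in
    the final bound.\<close>
  define V where "V = measure lborel (ball (0 :: 'a) 1)"
  have V: "V > 0" unfolding V_def by (rule content_ball_pos) simp
  have "X \<in> sets lebesgue" "C * V > 0"
    using X(2) C V by (simp_all add: null_setsD2)
  then obtain U where U: "open U" "X \<subseteq> U" "emeasure lebesgue (U - X) < ennreal (C * V)"
    by (rule sets_lebesgue_outer_open)
  have "emeasure lebesgue U = emeasure lebesgue ((U - X) \<union> X)"
    using U(2) by (simp add: Un_absorb2)
  also have "\<dots> = emeasure lebesgue (U - X)"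
    using X(2) U(1) by (intro emeasure_Un_null_set) auto
  finally have em: "emeasure lebesgue U < ennreal (C * V)" using U(3) by simp
  then have Um: "U \<in> lmeasurable"
    using U(1) by (intro fmeasurableI) (auto intro: order.strict_trans simp: ennreal_less_top)
  then have mU: "measure lebesgue U < C * V"
    using em C V by (simp add: emeasure_eq_measure2 ennreal_less_iff)
  obtain \<epsilon> where e: "\<epsilon> > 0" "(\<Union>x\<in>X. cball x \<epsilon>) \<subseteq> U"
    using compact_subset_open_imp_cball_epsilon_subset[OF X(1) U(1,2)] by blast
  have "real (card P) * \<delta> ^ DIM('a) < C"
    if d: "0 < \<delta>" "\<delta> \<le> \<epsilon>" and P: "finite P" "P \<subseteq> X"
      and sep: "\<forall>x\<in>P. \<forall>y\<in>P. x \<noteq> y \<longrightarrow> dist x y \<ge> 2 * \<delta>" for \<delta> P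
  proof -
    have disj: "disjoint_family_on (\<lambda>p. ball p \<delta>) P"
      unfolding disjoint_family_on_def using sep by (auto simp: disjoint_ballI)
    have ball: "measure lebesgue (ball p \<delta>) = \<delta> ^ DIM('a) * V" for p :: 'a
      using content_ball_conv_unit_ball[of \<delta> p] d by (simp add: V_def)
    have "real (card P) * (\<delta> ^ DIM('a) * V) = (\<Sum>p\<in>P. measure lebesgue (ball p \<delta>))"
      by (simp only: ball sum_constant)
    also have "\<dots> = measure lebesgue (\<Union>p\<in>P. ball p \<delta>)"
      using P disj fmeasurableD2[OF lmeasurable_ball]
      by (intro measure_finite_Union[symmetric]) auto
    also have "\<dots> \<le> measure lebesgue U"
    proof (rule measure_mono_fmeasurable)
      have "ball p \<delta> \<subseteq> cball p \<epsilon>" for p :: 'a using d by auto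
      then show "(\<Union>p\<in>P. ball p \<delta>) \<subseteq> U" using e(2) P by blast
    qed (use Um P in auto)
    also have "\<dots> < C * V" by (rule mU)
    finally show ?thesis using V by simp
  qed
  then show ?thesis using e(1) by blast
qed

section \<open>Projections along integral vectors\<close>

lemma integer_vector_norm_ge_1:
  fixes z :: "real ^ 'n"
  assumes "\<And>i. z $ i \<in> \<int>" "z \<noteq> 0"
  shows "norm z \<ge> 1"
proof -
  obtain i where "z $ i \<noteq> 0" using assms(2) by (auto simp: vec_eq_iff)
  then have "1 \<le> \<bar>z $ i\<bar>" using Ints_nonzero_abs_ge1 assms(1) by blast
  then show ?thesis using component_le_norm_cart[of z i] by linarith
qed

text \<open>
  The integral map \<open>z \<mapsto> z \<times> v\<close> has the same kernel as the projection along \<open>v\<close>, so it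
  factors through it.
\<close>
lemma projection_of_integer_vectors_discrete:
  assumes proj: "is_projection_along v \<phi>" and v: "\<And>i. v $ i \<in> \<int>"
  shows "\<exists>\<gamma>>0. \<forall>z. (\<forall>i. z $ i \<in> \<int>) \<longrightarrow> \<phi> z \<noteq> 0 \<longrightarrow> norm (\<phi> z) \<ge> \<gamma>"
proof -
  have lin: "linear \<phi>" and surj: "surj \<phi>" and ker: "\<And>x. \<phi> x = 0 \<longleftrightarrow> (\<exists>r. x = r *\<^sub>R v)"
    using proj unfolding is_projection_along_def by blast+
  obtain g where g: "linear g" "\<phi> \<circ> g = id"
    using linear_surjective_right_inverse[OF lin surj] by blast
  have v0: "v \<noteq> 0"
  proof
    assume "v = 0"
    then have "inj \<phi>"
      using ker lin by (simp add: linear_injective_0)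
    then have "dim (range \<phi>) = dim (UNIV :: (real ^ 3) set)"
      using lin by (intro dim_image_eq) auto
    then show False
      using surj by simp
  qed
  have lin\<psi>: "linear (\<lambda>y. cross3 (g y) v)"
    by (rule linearI)
      (simp_all add: linear_add[OF g(1)] linear_cmul[OF g(1)] cross_add_left cross_mult_left)
  then obtain B where B: "B > 0" "\<And>y. norm (cross3 (g y) v) \<le> B * norm y"
    using linear_bounded_pos by metis
  have "norm (\<phi> z) \<ge> 1 / B" if z: "\<And>i. z $ i \<in> \<int>" "\<phi> z \<noteq> 0" for z
  proof -
    \<comment> \<open>\<open>z\<close> and \<open>g (\<phi> z)\<close> differ by a multiple of
      \<open>v\<close>, so their cross products with \<open>v\<close> agree:
      \<open>cross3 z v\<close> is a linear function of \<open>\<phi> z\<close>.\<close>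
    have "\<phi> (z - g (\<phi> z)) = 0"
      using g(2) by (simp add: linear_diff[OF lin] pointfree_idE)
    then obtain r where "z - g (\<phi> z) = r *\<^sub>R v" using ker by blast
    then have "cross3 (z - g (\<phi> z)) v = 0" by (simp add: cross_mult_left)
    then have eq: "cross3 z v = cross3 (g (\<phi> z)) v"
      by (simp add: Cross3.left_diff_distrib)
    have "cross3 z v \<noteq> 0"
    proof
      assume "cross3 z v = 0"
      then have "collinear {0, v, z}"
        by (simp add: cross_eq_0 insert_commute)
      then show False
        using v0 z(2) ker by (auto simp: collinear_lemma)
    qed
    moreover have "cross3 z v $ i \<in> \<int>" for i
      using z(1) v exhaust_3[of i] by (auto simp: cross3_def intro!: Ints_diff Ints_mult)
    ultimately have "1 \<le> norm (cross3 z v)" by (intro integer_vector_norm_ge_1)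
    also have "\<dots> \<le> B * norm (\<phi> z)" using B(2) eq by simp
    finally show ?thesis using B(1) by (simp add: field_simps)
  qed
  then show ?thesis using B(1) by (intro exI[of _ "1 / B"]) auto
qed

section \<open>Null projections and collisions\<close>

text \<open>With \<open>card D = k ^ 2\<close> there are exactly \<open>(k ^ t) ^ 2\<close> strings
  of length \<open>t\<close>, matching the factor by which areas shrink. One collision makes the
  copies too few; without collisions the packing bound is violated.\<close>

lemma projected_attractor_null_iff_collision:
  fixes D :: "(real ^ 3) set" and \<phi> :: "real ^ 3 \<Rightarrow> real ^ 2"
  assumes k: "k \<ge> 2" and D: "\<And>d i. d \<in> D \<Longrightarrow> d $ i \<in> \<int>" and card: "card D = k ^ 2"
    and proj: "is_projection_along v \<phi>" and v: "\<And>i. v $ i \<in> \<int>"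
  shows "\<phi> ` attractor k D \<in> null_sets lebesgue \<longleftrightarrow>
    (\<exists>t. \<not> inj_on (\<lambda>ds. \<phi> (digit_value k ds)) (digit_strings D t))"
proof -
  define X where "X = \<phi> ` attractor k D"
  define f where "f = (\<lambda>ds. \<phi> (digit_value k ds))"
  have lin: "linear \<phi>" using proj unfolding is_projection_along_def by blast
  have "card D > 0" using k card by simp
  then have finD: "finite D" and neD: "D \<noteq> {}" by (auto simp: card_gt_0_iff)
  have fin: "finite (digit_strings D t)" for t
    using finD by (rule finite_digit_strings)
  have cardW: "real (card (digit_strings D t)) = (real k ^ t) ^ 2" for t
    by (simp add: card_digit_strings finD card power_mult[symmetric] mult.commute)
  note att = attractor_properties[OF k finD neD]
  have compX: "compact X" and neX: "X \<noteq> {}"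
    unfolding X_def using att(1,2) lin
    by (auto intro!: compact_continuous_image linear_continuous_on simp: linear_linear)
  have self_similar: "X = (\<Union>ds\<in>digit_strings D t. (\<lambda>x. (x + f ds) /\<^sub>R real k ^ t) ` X)" for t
  proof -
    have k0: "k > 0" using k by simp
    have "X = \<phi> ` (\<Union>ds\<in>digit_strings D t.
        (\<lambda>x. (x + digit_value k ds) /\<^sub>R real k ^ t) ` attractor k D)"
      using hutchinson_fixpoint_iterate[OF k0 att(3), of t] X_def by simp
    also have "\<dots> = (\<Union>ds\<in>digit_strings D t. (\<lambda>x. (x + f ds) /\<^sub>R real k ^ t) ` X)"
      unfolding X_def f_def image_UN image_image linear_cmul[OF lin] linear_add[OF lin] ..
    finally show ?thesis .
  qed
  have "X \<in> null_sets lebesgue" if "\<not> inj_on f (digit_strings D t)" for t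
  proof (rule null_set_if_few_scaled_copies)
    show "compact X" by (rule compX)
    show "finite (f ` digit_strings D t)" using fin by simp
    show "X \<subseteq> (\<Union>s\<in>f ` digit_strings D t. (\<lambda>x. (x + s) /\<^sub>R real k ^ t) ` X)"
      using self_similar[of t] by auto
    show "real k ^ t > 0" using k by simp
    have "card (f ` digit_strings D t) < card (digit_strings D t)"
      using that fin card_image_le[OF fin] inj_on_iff_eq_card[OF fin] le_neq_implies_less by blast
    then show "real (card (f ` digit_strings D t)) < (real k ^ t) ^ DIM(real ^ 2)"
      using cardW[of t] by simp
  qed
  moreover have "X \<notin> null_sets lebesgue" if inj: "\<And>t. inj_on f (digit_strings D t)"
  proof
    assume null: "X \<in> null_sets lebesgue"
    obtain \<gamma> where \<gamma>: "\<gamma> > 0"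
        "\<And>z. (\<forall>i. z $ i \<in> \<int>) \<Longrightarrow> \<phi> z \<noteq> 0 \<Longrightarrow> norm (\<phi> z) \<ge> \<gamma>"
      using projection_of_integer_vectors_discrete[OF proj v] by blast
    \<comment> \<open>The constant is what \<open>(k ^ t) ^ 2\<close> discs of radius
      \<open>\<gamma> / 2 / k ^ t\<close> yield for every \<open>t\<close>, so the strict inequality
      will fail.\<close>
    obtain \<epsilon> where \<epsilon>: "\<epsilon> > 0" "\<And>\<delta> P. 0 < \<delta> \<Longrightarrow> \<delta> \<le> \<epsilon> \<Longrightarrow> finite P \<Longrightarrow> P \<subseteq> X \<Longrightarrow>
        (\<forall>x\<in>P. \<forall>y\<in>P. x \<noteq> y \<longrightarrow> dist x y \<ge> 2 * \<delta>) \<Longrightarrow>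
        real (card P) * \<delta> ^ DIM(real ^ 2) < (\<gamma> / 2) ^ 2"
      using packing_in_compact_null_set[OF compX null, of "(\<gamma> / 2) ^ 2"] \<gamma>(1) by auto
    \<comment> \<open>This choice of \<open>t\<close> makes \<open>\<delta>\<close> at most
      \<open>\<epsilon>\<close>.\<close>
    obtain t where t: "\<gamma> / 2 / \<epsilon> < real k ^ t"
      using real_arch_pow[of "real k" "\<gamma> / 2 / \<epsilon>"] k by auto
    obtain x0 where x0: "x0 \<in> X" using neX by blast
    define h where "h = (\<lambda>ds. (x0 + f ds) /\<^sub>R real k ^ t)"
    define \<delta> where "\<delta> = \<gamma> / 2 / real k ^ t"
    let ?W = "digit_strings D t"
    have kt: "real k ^ t > 0" using k by simp
    have sep: "dist (h xs) (h ys) \<ge> 2 * \<delta>" if W: "xs \<in> ?W" "ys \<in> ?W" "xs \<noteq> ys" for xs ys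
    proof -
      have "f xs - f ys = \<phi> (digit_value k xs - digit_value k ys)"
        by (simp add: f_def linear_diff[OF lin])
      moreover have "f xs - f ys \<noteq> 0" using inj W by (auto dest: inj_onD)
      moreover have "(digit_value k xs - digit_value k ys) $ i \<in> \<int>" for i
        using W digit_value_Ints[of D _ k i, OF D] by (auto simp: digit_strings_def intro!: Ints_diff)
      ultimately have "norm (f xs - f ys) \<ge> \<gamma>" using \<gamma>(2) by metis
      moreover have "h xs - h ys = (f xs - f ys) /\<^sub>R real k ^ t"
        by (simp add: h_def algebra_simps)
      ultimately show ?thesis
        using kt by (simp add: dist_norm \<delta>_def divide_simps)
    qed
    have \<delta>: "0 < \<delta>" "\<delta> \<le> \<epsilon>"
      using \<gamma>(1) kt t \<epsilon>(1) by (auto simp: \<delta>_def field_simps)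
    \<comment> \<open>Separation by a positive distance shows that no points are lost: the packing
      has one point per string.\<close>
    have "inj_on h ?W"
      using sep \<delta>(1) by (force intro!: inj_onI)
    then have "card (h ` ?W) = card ?W" by (rule card_image)
    moreover have "real (card (h ` ?W)) * \<delta> ^ DIM(real ^ 2) < (\<gamma> / 2) ^ 2"
    proof (rule \<epsilon>(2)[OF \<delta>])
      show "finite (h ` ?W)" using fin by simp
      show "h ` ?W \<subseteq> X"
        using x0 self_similar[of t] unfolding h_def by blast
      show "\<forall>x\<in>h ` ?W. \<forall>y\<in>h ` ?W. x \<noteq> y \<longrightarrow> dist x y \<ge> 2 * \<delta>"
        using sep by blast
    qed
    ultimately show False
      using k cardW[of t] by (simp add: \<delta>_def power_divide)
  qed
  ultimately show ?thesis unfolding X_def f_def by blast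
qed

theorem theorem12:
  fixes k :: nat
    and D :: "(real ^ 3) set"
    and a b c :: int
    and \<phi> :: "real ^ 3 \<Rightarrow> real ^ 2"
  assumes "k \<ge> 2"
    and "\<And>d i. d \<in> D \<Longrightarrow> d $ i \<in> \<int>"
    and "card D = k ^ 2"
    and "gcd (gcd a b) c = 1"
    and "is_projection_along (vector [of_int a, of_int b, of_int c]) \<phi>"
  shows "\<phi> ` attractor k D \<in> null_sets lebesgue \<longleftrightarrow>
    (\<exists>j::real. j \<noteq> 0 \<and>
       vector [j * of_int a, j * of_int b, j * of_int c] \<in> expandable k (differences D)) \<or>
    (\<exists>t\<ge>1. \<exists>ds. length ds = t \<and> is_expansion k (differences D) ds 0 \<and> ds \<noteq> replicate t 0)"
    (is "_ \<longleftrightarrow> ?multiple \<or> ?zero")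
proof -
  define v :: "real ^ 3" where "v = vector [of_int a, of_int b, of_int c]"
  have proj: "is_projection_along v \<phi>" using assms(5) by (simp add: v_def)
  then have lin: "linear \<phi>" and ker: "\<And>x. \<phi> x = 0 \<longleftrightarrow> (\<exists>r. x = r *\<^sub>R v)"
    unfolding is_projection_along_def by blast+
  have v_int: "v $ i \<in> \<int>" for i
    using exhaust_3[of i] by (auto simp: v_def)
  have v0: "v \<noteq> 0"
  proof
    assume "v = 0"
    then have "v $ 1 = 0" "v $ 2 = 0" "v $ 3 = 0" by simp_all
    then have "a = 0" "b = 0" "c = 0" by (simp_all add: v_def)
    then show False using assms(4) by simp
  qed
  have scale: "vector [j * of_int a, j * of_int b, j * of_int c] = j *\<^sub>R v" for j :: real
    by (simp add: v_def vec_eq_iff forall_3)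
  have expansion: "is_expansion k E ds x \<longleftrightarrow> set ds \<subseteq> E \<and> x = digit_value k ds"
    for E ds and x :: "real ^ 3"
    by (simp add: is_expansion_def digit_value_def)
  have replicate_0: "digit_value k (replicate t 0 :: (real ^ 3) list) = 0" for t
    by (induction t) auto
  \<comment> \<open>Both alternatives in one: the value of a nontrivial difference string lies on
    the line spanned by \<open>v\<close>, either away from the origin or at it.\<close>
  let ?null = "\<lambda>ds. set ds \<subseteq> differences D \<and> \<phi> (digit_value k ds) = 0 \<and>
    ds \<noteq> replicate (length ds) 0"
  have "\<phi> ` attractor k D \<in> null_sets lebesgue \<longleftrightarrow>
      (\<exists>t. \<not> inj_on (\<lambda>ds. \<phi> (digit_value k ds)) (digit_strings D t))"
    using assms(1-3) proj v_int by (rule projected_attractor_null_iff_collision)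
  also have "\<dots> \<longleftrightarrow> (\<exists>ds. ?null ds)"
    unfolding collision_iff_difference_expansion[OF lin] by auto
  also have "\<dots> \<longleftrightarrow> ?multiple \<or> ?zero"
  proof
    assume "\<exists>ds. ?null ds"
    then obtain ds where ds: "?null ds" by blast
    \<comment> \<open>The empty string equals \<open>replicate 0 0\<close>, so a nontrivial string
      has length at least 1.\<close>
    then have len: "length ds \<ge> 1" by (cases ds) auto
    obtain j where j: "digit_value k ds = j *\<^sub>R v" using ds ker by blast
    show "?multiple \<or> ?zero"
    proof (cases "j = 0")
      case True
      then show ?thesis
        using ds len j unfolding expansion by (intro disjI2 exI[of _ "length ds"]) auto
    next
      case False
      then show ?thesis
        using ds len j unfolding expansion expandable_def scale
        by (metis (mono_tags, lifting) mem_Collect_eq)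
    qed
  next
    assume "?multiple \<or> ?zero"
    then show "\<exists>ds. ?null ds"
    proof
      assume ?multiple
      then obtain j ds where j: "j \<noteq> 0" "set ds \<subseteq> differences D" "j *\<^sub>R v = digit_value k ds"
        unfolding expandable_def scale expansion by blast
      have "\<phi> (digit_value k ds) = 0" using j(3) ker by metis
      \<comment> \<open>The trivial string has value 0, whereas \<open>j *\<^sub>R v\<close> is
        nonzero.\<close>
      moreover have "ds \<noteq> replicate (length ds) 0"
        using j v0 replicate_0 by (metis scaleR_eq_0_iff)
      ultimately show ?thesis using j(2) by blast
    next
      assume ?zero
      then show ?thesis
        unfolding expansion using linear_0[OF lin] by metis
    qed
  qed
  finally show ?thesis .
qed

end
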